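(* Let $X$ be a Banach space over $\mathbb K\in\{\mathbb R,\mathbb C\}$ with the Daugavet property, and let $Y\subset X$ be a proper closed subspace of finite codimension $n$. Then \[ 2\leqslant \lambda(Y,X)\leqslant 1+\sqrt n. \] In particular, every (closed) hyperplane in $X$ has projection constant $2$ in $X$.
   Context: For a closed subspace $E$ of a Banach space $F$, the projection constant of $E$ in $F$ is $\lambda(E,F)=\inf\{\|P\| : P\colon F\to E \text{ bounded linear},\ P|_E=\mathrm{Id}_E\}$. A Banach space $X$ has the Daugavet property if every bounded rank-one operator $T\colon X\to X$ satisfies $\|\mathrm{Id}_X+T\|=1+\|T\|$. A closed hyperplane is a closed subspace of codimension $1$. *)

theory Defs
  imports "HOL-Analysis.Analysis"
begin

text \<open>
  The scalar field is \<open>\<real>\<close> or \<open>\<complex>\<close>. The axioms make \<open>to_complex\<close> an isometric isomorphism of real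
  algebras onto \<open>\<real>\<close> or onto \<open>\<complex>\<close>, so that, up to isometric isomorphism, these two fields are the
  only instances.
\<close>

class real_or_complex = real_normed_field +
  fixes to_complex :: "'a \<Rightarrow> complex"
  assumes to_complex_add: "to_complex (x + y) = to_complex x + to_complex y"
    and to_complex_mult: "to_complex (x * y) = to_complex x * to_complex y"
    and to_complex_scaleR_one: "to_complex (r *\<^sub>R 1) = complex_of_real r"
    and norm_to_complex: "norm (to_complex x) = norm x"
    and range_to_complex: "range to_complex = \<real> \<or> range to_complex = UNIV"

instantiation real :: real_or_complex
begin
definition to_complex_real :: "real \<Rightarrow> complex" where
  "to_complex_real = complex_of_real"
instance
  by standard (simp_all add: to_complex_real_def Reals_def)
end

instantiation complex :: real_or_complex
begin
definition to_complex_complex :: "complex \<Rightarrow> complex" where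
  "to_complex_complex = id"
instance
  by standard (simp_all add: to_complex_complex_def scaleR_conv_of_real)
end

text \<open>
  A Banach space over the field \<open>'k\<close>. Norm and completeness come from the class \<open>banach\<close>, whose
  built-in real scaling has to be the restriction of \<open>scale\<close> to the reals.
\<close>

locale banach_over = vector_space scale
  for scale :: "'k::real_or_complex \<Rightarrow> 'a::banach \<Rightarrow> 'a" +
  assumes norm_scale: "norm (scale c x) = norm c * norm x"
    and scale_of_real: "scale (of_real r) x = r *\<^sub>R x"
begin

definition bounded_operator :: "('a \<Rightarrow> 'a) \<Rightarrow> bool" where
  "bounded_operator T \<longleftrightarrow> Vector_Spaces.linear scale scale T \<and> bounded_linear T"

definition rank_one :: "('a \<Rightarrow> 'a) \<Rightarrow> bool" where
  "rank_one T \<longleftrightarrow> dim (range T) = 1"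

definition daugavet_property :: bool where
  "daugavet_property \<longleftrightarrow>
     (\<forall>T. bounded_operator T \<and> rank_one T \<longrightarrow> onorm (\<lambda>x. x + T x) = 1 + onorm T)"

definition closed_subspace :: "'a set \<Rightarrow> bool" where
  "closed_subspace Y \<longleftrightarrow> subspace Y \<and> closed Y"

text \<open>
  \<open>dim (X / Y) = n\<close>: the cosets of the vectors in \<open>B\<close> form a basis of the quotient. The first
  condition on \<open>B\<close> is their linear independence, which also makes them pairwise distinct; the
  second says that they span.
\<close>

definition has_codim :: "'a set \<Rightarrow> nat \<Rightarrow> bool" where
  "has_codim Y n \<longleftrightarrow>
     (\<exists>B. finite B \<and> card B = n \<and>
        (\<forall>c. (\<Sum>b\<in>B. scale (c b) b) \<in> Y \<longrightarrow> (\<forall>b\<in>B. c b = 0)) \<and>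
        (\<forall>x. \<exists>c. x - (\<Sum>b\<in>B. scale (c b) b) \<in> Y))"

definition closed_hyperplane :: "'a set \<Rightarrow> bool" where
  "closed_hyperplane H \<longleftrightarrow> closed_subspace H \<and> has_codim H 1"

definition projections_onto :: "'a set \<Rightarrow> ('a \<Rightarrow> 'a) set" where
  "projections_onto Y = {P. bounded_operator P \<and> range P \<subseteq> Y \<and> (\<forall>y\<in>Y. P y = y)}"

text \<open>
  The infimum is taken in the extended reals, so that it is \<open>\<infinity>\<close> when there is no bounded projection
  onto \<open>Y\<close>; over the type \<open>real\<close> the infimum of the empty set would be unspecified.
\<close>

definition projection_constant :: "'a set \<Rightarrow> ereal" where
  "projection_constant Y = (INF P\<in>projections_onto Y. ereal (onorm P))"

end

lemma banach_over_scaleR: "banach_over (scaleR :: real \<Rightarrow> 'a::banach \<Rightarrow> 'a)"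
  by unfold_locales (simp_all add: algebra_simps)

end

theory Submission
  imports Defs "Jordan_Normal_Form.Determinant"
begin

text \<open>
  The two bounds have independent proofs. Both use bounded functionals \<open>q 0, \<dots>, q (n - 1)\<close> whose common
  kernel is \<open>Y\<close>, and write \<open>q(x)\<close> for the column of their values at \<open>x\<close>. Their boundedness is where the
  closedness of \<open>Y\<close> enters (\<open>quotient_coordinates_exist\<close>). The projections \<open>P\<close> onto \<open>Y\<close> correspond to the
  operators \<open>Q = Id - P\<close> that vanish on \<open>Y\<close> and satisfy \<open>q(Q x) = q(x)\<close>.

  The upper bound is a dual form of the theorem of Kadec and Snobar, and a suitable \<open>Q\<close> can be written down directly. For a finitely supported probability weight \<open>p\<close> on the
  unit ball, with invertible moment matrix \<open>M = \<Sum>x. p(x) q(x) q(x)\<^sup>*\<close>, the operator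
  \<open>Q y = \<Sum>x. p(x) (q(x)\<^sup>* M\<^sup>-\<^sup>1 q(y)) x\<close> has the required form, and by the Cauchy-Schwarz inequality
  \<open>\<parallel>Q y\<parallel>\<^sup>2 \<le> q(y)\<^sup>* M\<^sup>-\<^sup>1 q(y)\<close> (\<open>projection_from_design\<close>). If \<open>p\<close> almost maximises \<open>det M\<close>, then moving a little
  mass to \<open>y\<close> cannot increase the determinant by much. By the matrix determinant lemma this says that
  \<open>q(y)\<^sup>* M\<^sup>-\<^sup>1 q(y) \<le> n + \<epsilon>\<close> for all \<open>y\<close> in the unit ball (\<open>near_optimal_design_exists\<close>). This determinant
  argument takes the place of John's ellipsoid. Hence \<open>\<parallel>P\<parallel> \<le> 1 + sqrt (n + \<epsilon>)\<close>.

  For the lower bound, the Daugavet property says that every slice of the unit ball contains points \<open>y\<close>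
  almost at distance \<open>1 + \<parallel>x0\<parallel>\<close> from a given vector \<open>x0\<close> (\<open>daugavet_slice\<close>). As \<open>Q\<close> has finite rank, there is
  a slice on which \<open>Q\<close> is almost constant, with a value \<open>x0\<close> of norm almost at least \<open>1\<close>: take the slice
  around a point of the unit ball at which the Euclidean norm of \<open>q\<close> is almost maximal. On that slice
  \<open>P y = y - Q y\<close> is close to \<open>y - x0\<close>, so that \<open>\<parallel>P\<parallel> \<ge> 2\<close> (\<open>norm_projection_ge\<close>). In codimension one the two
  bounds coincide.
\<close>

section \<open>Determinants\<close>

text \<open>
  Both sides are the determinant of the block matrix with blocks \<open>1, U, -V, 1\<close>, factored once as lower
  times upper and once as upper times lower triangular block matrix.
\<close>

lemma det_one_plus_mult_commute:
  fixes U V :: "'a::idom mat"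
  assumes U: "U \<in> carrier_mat n m" and V: "V \<in> carrier_mat m n"
  shows "Determinant.det (1\<^sub>m n + U * V) = Determinant.det (1\<^sub>m m + V * U)"
proof -
  let ?L = "four_block_mat (1\<^sub>m n) (0\<^sub>m n m) (- V) (1\<^sub>m m)"
  let ?R = "four_block_mat (1\<^sub>m n) U (0\<^sub>m m n) (1\<^sub>m m + V * U)"
  let ?R' = "four_block_mat (1\<^sub>m n + U * V) U (0\<^sub>m m n) (1\<^sub>m m)"
  have c: "?L \<in> carrier_mat (n+m) (n+m)" "?R \<in> carrier_mat (n+m) (n+m)" "?R' \<in> carrier_mat (n+m) (n+m)"
    using U V by auto
  have LR: "?L * ?R = four_block_mat (1\<^sub>m n) U (- V) (1\<^sub>m m)"
    by (subst mult_four_block_mat[of _ n n _ m _ m _ _ n _ m]) (use U V in \<open>auto intro!: eq_matI\<close>)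
  have R'L: "?R' * ?L = four_block_mat (1\<^sub>m n) U (- V) (1\<^sub>m m)"
    by (subst mult_four_block_mat[of _ n n _ m _ m _ _ n _ m])
      (use U V in \<open>auto intro!: eq_matI simp: uminus_mult_right_mat\<close>)
  have dL: "Determinant.det ?L = 1"
    by (subst det_four_block_mat_upper_right_zero[of _ n _ m]) (use V in auto)
  have dR: "Determinant.det ?R = Determinant.det (1\<^sub>m m + V * U)"
    by (subst det_four_block_mat_lower_left_zero[of _ n _ m]) (use U V in auto)
  have dR': "Determinant.det ?R' = Determinant.det (1\<^sub>m n + U * V)"
    by (subst det_four_block_mat_lower_left_zero[of _ n _ m]) (use U V in auto)
  have "Determinant.det (?L * ?R) = Determinant.det (?R' * ?L)"
    using LR R'L by simp
  then show ?thesis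
    using det_mult[OF c(1,2)] det_mult[OF c(3,1)] dL dR dR' by simp
qed

text \<open>
  The matrix determinant lemma, for a column \<open>u\<close> in the image of the matrix: since \<open>u = m w\<close>, the
  matrix factors out of the update, and the second factor is the identity plus a matrix of rank one.
  The vector \<open>w\<close> stands for \<open>m\<^sup>-\<^sup>1 u\<close>.
\<close>

lemma det_rank_one_update:
  fixes m :: "nat \<Rightarrow> nat \<Rightarrow> 'a::idom"
  assumes w: "\<And>i. i < n \<Longrightarrow> (\<Sum>k<n. m i k * w k) = u i"
  shows "Determinant.det (mat n n (\<lambda>(i, k). m i k + u i * v k)) =
    Determinant.det (mat n n (\<lambda>(i, k). m i k)) * (1 + (\<Sum>k<n. v k * w k))"
proof -
  let ?M = "mat n n (\<lambda>(i, k). m i k)"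
  let ?W = "mat n 1 (\<lambda>(i, _). w i)" and ?V = "mat 1 n (\<lambda>(_, k). v k)"
  have "mat n n (\<lambda>(i, k). m i k + u i * v k) = ?M * (1\<^sub>m n + ?W * ?V)"
  proof (rule eq_matI)
    fix i k assume "i < dim_row (?M * (1\<^sub>m n + ?W * ?V))" "k < dim_col (?M * (1\<^sub>m n + ?W * ?V))"
    then have ik: "i < n" "k < n" by auto
    have "(?M * (1\<^sub>m n + ?W * ?V)) $$ (i, k) = (\<Sum>l<n. m i l * ((if l = k then 1 else 0) + w l * v k))"
      using ik by (auto simp: scalar_prod_def lessThan_atLeast0 intro!: sum.cong)
    also have "\<dots> = (\<Sum>l<n. (if l = k then m i l else 0) + m i l * w l * v k)"
      by (intro sum.cong) (auto simp: algebra_simps)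
    also have "\<dots> = m i k + u i * v k"
      using ik w[of i] by (simp add: sum.distrib flip: sum_distrib_right)
    finally show "mat n n (\<lambda>(i, k). m i k + u i * v k) $$ (i, k) = (?M * (1\<^sub>m n + ?W * ?V)) $$ (i, k)"
      using ik by simp
  qed auto
  moreover have "Determinant.det (1\<^sub>m n + ?W * ?V) = Determinant.det (1\<^sub>m 1 + ?V * ?W)"
    by (rule det_one_plus_mult_commute) auto
  moreover have "Determinant.det (1\<^sub>m 1 + ?V * ?W) = 1 + (\<Sum>k<n. v k * w k)"
    by (subst det_single) (auto simp: scalar_prod_def lessThan_atLeast0)
  moreover have "1\<^sub>m n + ?W * ?V \<in> carrier_mat n n"
    by (intro add_carrier_mat mult_carrier_mat[of _ n 1]) auto
  ultimately show ?thesis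
    using det_mult[of ?M n "1\<^sub>m n + ?W * ?V"] by simp
qed

lemma right_inverse_of_det_nonzero:
  fixes m :: "nat \<Rightarrow> nat \<Rightarrow> 'a::field"
  assumes "Determinant.det (mat n n (\<lambda>(i, k). m i k)) \<noteq> 0"
  obtains N where "\<And>i k. i < n \<Longrightarrow> k < n \<Longrightarrow> (\<Sum>l<n. m i l * N l k) = (if i = k then 1 else 0)"
proof -
  let ?M = "mat n n (\<lambda>(i, k). m i k)"
  have M: "?M \<in> carrier_mat n n" by simp
  from det_non_zero_imp_unit[OF M assms, of "()"]
  obtain N where N: "N \<in> carrier_mat n n" "?M * N = 1\<^sub>m n"
    unfolding Units_def by (auto simp: ring_mat_def)
  have "(\<Sum>l<n. m i l * N $$ (l, k)) = (if i = k then 1 else 0)" if "i < n" "k < n" for i k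
  proof -
    have "(?M * N) $$ (i, k) = (\<Sum>l<n. m i l * N $$ (l, k))"
      using that N(1) by (auto simp: scalar_prod_def lessThan_atLeast0 intro!: sum.cong)
    then show ?thesis using N(2) that by simp
  qed
  then show ?thesis by (rule that)
qed

lemma norm_det_le:
  fixes m :: "nat \<Rightarrow> nat \<Rightarrow> 'a::real_normed_field"
  assumes "\<And>i k. i < n \<Longrightarrow> k < n \<Longrightarrow> norm (m i k) \<le> C"
  shows "norm (Determinant.det (mat n n (\<lambda>(i, k). m i k))) \<le> fact n * C ^ n"
proof -
  let ?P = "{p. p permutes {0..<n}}"
  have "norm (Determinant.det (mat n n (\<lambda>(i, k). m i k))) \<le>
      (\<Sum>p\<in>?P. norm (signof p * (\<Prod>i = 0..<n. mat n n (\<lambda>(i, k). m i k) $$ (i, p i))))"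
    by (subst det_def'[of _ n]) (auto intro: norm_sum)
  also have "\<dots> \<le> (\<Sum>p\<in>?P. C ^ n)"
  proof (rule sum_mono)
    fix p assume p: "p \<in> ?P"
    have "norm (\<Prod>i = 0..<n. mat n n (\<lambda>(i, k). m i k) $$ (i, p i)) = (\<Prod>i = 0..<n. norm (m i (p i)))"
      using p by (auto simp: prod_norm[symmetric] intro!: prod.cong)
    also have "\<dots> \<le> (\<Prod>i = 0..<n. C)"
      using p assms by (intro prod_mono) auto
    finally show "norm (signof p * (\<Prod>i = 0..<n. mat n n (\<lambda>(i, k). m i k) $$ (i, p i))) \<le> C ^ n"
      by (simp add: norm_mult sign_def)
  qed
  also have "\<dots> = fact n * C ^ n"
    using card_permutations[of "{0..<n}" n] by simp
  finally show ?thesis .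
qed

lemma det_const_mult:
  "Determinant.det (mat n n (\<lambda>(i, k). c * m i k)) =
    c ^ n * Determinant.det (mat n n (\<lambda>(i, k). m i k :: 'a::comm_ring_1))"
proof -
  have "mat n n (\<lambda>(i, k). c * m i k) = c \<cdot>\<^sub>m mat n n (\<lambda>(i, k). m i k)"
    by (rule eq_matI) auto
  then show ?thesis by simp
qed

lemma det_diagonal:
  "Determinant.det (mat n n (\<lambda>(i, k). if i = k then d i else (0::'a::comm_ring_1))) = (\<Prod>i<n. d i)"
  by (subst det_upper_triangular[of _ n])
    (auto simp: diag_mat_def upper_triangular_def lessThan_atLeast0
      intro!: arg_cong[of _ _ prod_list] simp flip: prod.list_conv_set_nth prod.distinct_set_conv_list)

section \<open>Scalars and coordinates modulo a closed subspace\<close>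

lemma to_complex_of_real [simp]: "to_complex (of_real r :: 'k::real_or_complex) = complex_of_real r"
  using to_complex_scaleR_one[of r, where 'a = 'k] by (simp add: of_real_def)

lemma to_complex_0 [simp]: "to_complex (0 :: 'k::real_or_complex) = 0"
  using to_complex_of_real[of 0, where 'k = 'k] by simp

lemma to_complex_diff: "to_complex (x - y :: 'k::real_or_complex) = to_complex x - to_complex y"
  using to_complex_add[of "x - y" y] by (simp add: algebra_simps)

lemma to_complex_sum: "to_complex (\<Sum>i\<in>A. f i :: 'k::real_or_complex) = (\<Sum>i\<in>A. to_complex (f i))"
  by (induction A rule: infinite_finite_induct) (simp_all add: to_complex_add)

lemma inj_to_complex: "inj (to_complex :: 'k::real_or_complex \<Rightarrow> complex)"
proof (rule injI)
  fix x y :: 'k assume "to_complex x = to_complex y"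
  then have "norm (to_complex (x - y)) = 0"
    by (simp add: to_complex_diff)
  then have "norm (x - y) = 0"
    by (simp only: norm_to_complex)
  then show "x = y" by simp
qed

lemmas to_complex_eqI = injD[OF inj_to_complex]

definition conj_scalar :: "'k::real_or_complex \<Rightarrow> 'k" where
  "conj_scalar c = inv_into UNIV to_complex (cnj (to_complex c))"

lemma to_complex_conj_scalar [simp]: "to_complex (conj_scalar c) = cnj (to_complex c)"
proof -
  have "cnj (to_complex c) \<in> range (to_complex :: 'a \<Rightarrow> complex)"
    using range_to_complex[where 'a = 'a]
  proof
    assume R: "range (to_complex :: 'a \<Rightarrow> complex) = \<real>"
    then have "to_complex c \<in> \<real>" by blast
    then show ?thesis by (simp add: Reals_cnj_iff)
  qed simp
  then show ?thesis
    unfolding conj_scalar_def by (rule f_inv_into_f)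
qed

lemma norm_conj_scalar [simp]: "norm (conj_scalar c) = norm c"
  using norm_to_complex[of "conj_scalar c"] norm_to_complex[of c] by simp

lemma conj_scalar_mult: "conj_scalar (c * d) = conj_scalar c * conj_scalar d"
  by (rule to_complex_eqI) (simp add: to_complex_mult)

lemma conj_scalar_sum: "conj_scalar (\<Sum>i\<in>A. f i) = (\<Sum>i\<in>A. conj_scalar (f i))"
  by (rule to_complex_eqI) (simp add: to_complex_sum)

lemma conj_scalar_of_real [simp]: "conj_scalar (of_real r) = of_real r"
  by (rule to_complex_eqI) simp

lemma conj_scalar_0 [simp]: "conj_scalar 0 = 0"
  by (rule to_complex_eqI) simp

lemma mult_conj_scalar_self: "c * conj_scalar c = of_real ((norm c)\<^sup>2)"
  by (rule to_complex_eqI) (simp add: to_complex_mult complex_norm_square[symmetric] norm_to_complex del: of_real_power)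

text \<open>
  The image of \<open>to_complex\<close> is closed in \<open>\<complex>\<close>, so the completeness of \<open>\<complex>\<close> passes to the scalars.
\<close>

lemma convergent_if_Cauchy_scalar:
  fixes c :: "nat \<Rightarrow> 'k::real_or_complex"
  assumes "Cauchy c"
  shows "convergent c"
proof -
  have dist: "dist (to_complex x) (to_complex y) = dist x y" for x y :: 'k
    by (simp add: dist_norm norm_to_complex flip: to_complex_diff)
  have "Cauchy (\<lambda>n. to_complex (c n))"
    using assms by (simp add: Cauchy_def dist)
  then obtain l where l: "(\<lambda>n. to_complex (c n)) \<longlonglongrightarrow> l"
    using Cauchy_convergent convergent_def by blast
  have "closed (range (to_complex :: 'k \<Rightarrow> complex))"
    using range_to_complex[where 'a = 'k] closed_complex_Reals by auto
  then have "l \<in> range (to_complex :: 'k \<Rightarrow> complex)"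
    by (rule closed_sequentially[OF _ _ l]) auto
  then obtain d :: 'k where "l = to_complex d" by auto
  then have "c \<longlonglongrightarrow> d"
    using l unfolding tendsto_iff by (simp add: dist)
  then show ?thesis by (rule convergentI)
qed

context banach_over
begin

text \<open>
  Here \<open>d\<close> is the distance from \<open>b\<close> to \<open>W\<close>: dividing \<open>w + scale c b\<close> by \<open>c\<close> gives a vector whose distance
  to the origin is the distance from \<open>b\<close> to an element of \<open>W\<close>. So the coordinate along \<open>b\<close>, modulo \<open>W\<close>,
  is a bounded functional.
\<close>

lemma norm_add_scale_ge:
  assumes W: "closed_subspace W" and b: "b \<notin> W"
  obtains d where "d > 0" "\<And>w c. w \<in> W \<Longrightarrow> d * norm c \<le> norm (w + scale c b)"
proof -
  have sub: "subspace W" and "closed W"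
    using W by (auto simp: closed_subspace_def)
  then obtain d where d: "d > 0" "ball b d \<subseteq> - W"
    using b openE[of "- W" b] by (auto simp: open_Compl)
  have "d * norm c \<le> norm (w + scale c b)" if w: "w \<in> W" for w c
  proof (cases "c = 0")
    case False
    have "scale (- inverse c) w \<in> W"
      using sub w by (rule subspace_scale)
    then have "d \<le> dist b (scale (- inverse c) w)"
      using d(2) by (meson ComplD linorder_not_le mem_ball subsetD)
    then have "norm c * d \<le> norm c * norm (b - scale (- inverse c) w)"
      unfolding dist_norm by (rule mult_left_mono) simp
    then have "d * norm c \<le> norm c * norm (b - scale (- inverse c) w)"
      by (simp only: mult.commute)
    also have "\<dots> = norm (scale c (b - scale (- inverse c) w))"
      by (simp add: norm_scale)
    also have "scale c (b - scale (- inverse c) w) = w + scale c b"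
      using False by (simp add: scale_right_diff_distrib algebra_simps)
    finally show ?thesis .
  qed simp
  with d(1) show ?thesis by (rule that)
qed

text \<open>
  When a sequence in the sum of \<open>W\<close> and the line converges, its coordinates along \<open>b\<close> form a Cauchy
  sequence by the preceding estimate; so they converge, and hence so do the parts in \<open>W\<close>.
\<close>

lemma closed_subspace_add_line:
  assumes W: "closed_subspace W"
  shows "closed_subspace {x. \<exists>c. x - scale c b \<in> W}"
proof (cases "b \<in> W")
  case True
  have "x - scale c b \<in> W \<longleftrightarrow> x \<in> W" for x c
    using W True unfolding closed_subspace_def
    by (metis diff_add_cancel subspace_add subspace_diff subspace_scale)
  then show ?thesis using W by simp
next
  case False
  have sub: "subspace W" and cl: "closed W"
    using W by (auto simp: closed_subspace_def)
  obtain d where d: "d > 0" "\<And>w c. w \<in> W \<Longrightarrow> d * norm c \<le> norm (w + scale c b)"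
    using norm_add_scale_ge[OF W False] by blast
  have "closed {x. \<exists>c. x - scale c b \<in> W}"
    unfolding closed_sequential_limits
  proof (intro allI impI, elim conjE)
    fix x l assume "\<forall>n. x n \<in> {x. \<exists>c. x - scale c b \<in> W}" and l: "x \<longlonglongrightarrow> l"
    then obtain c where c: "\<And>n. x n - scale (c n) b \<in> W"
      by simp metis
    have cx: "norm (c m - c n) \<le> norm (x m - x n) / d" for m n
    proof -
      have "(x m - scale (c m) b) - (x n - scale (c n) b) \<in> W"
        by (rule subspace_diff[OF sub c c])
      from d(2)[OF this, of "c m - c n"] show ?thesis
        using d(1) by (simp add: scale_left_diff_distrib algebra_simps pos_le_divide_eq)
    qed
    have "Cauchy c"
    proof (rule CauchyI)
      fix e :: real assume "e > 0"
      with d(1) LIMSEQ_imp_Cauchy[OF l]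
      obtain M where "\<forall>m\<ge>M. \<forall>n\<ge>M. norm (x m - x n) < e * d"
        by (meson CauchyD mult_pos_pos)
      then show "\<exists>M. \<forall>m\<ge>M. \<forall>n\<ge>M. norm (c m - c n) < e"
        using d(1) cx by (meson le_less_trans pos_divide_less_eq)
    qed
    then obtain k where k: "c \<longlonglongrightarrow> k"
      using convergent_if_Cauchy_scalar convergent_def by blast
    have "(\<lambda>n. scale (c n - k) b) \<longlonglongrightarrow> 0"
    proof (rule tendsto_norm_zero_cancel)
      have "(\<lambda>n. norm (c n - k) * norm b) \<longlonglongrightarrow> norm (k - k) * norm b"
        by (intro tendsto_intros k)
      then show "(\<lambda>n. norm (scale (c n - k) b)) \<longlonglongrightarrow> 0"
        by (simp add: norm_scale)
    qed
    from tendsto_diff[OF l tendsto_add[OF this tendsto_const[of "scale k b"]]]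
    have "(\<lambda>n. x n - scale (c n) b) \<longlonglongrightarrow> l - scale k b"
      by (simp add: scale_left_diff_distrib)
    from closed_sequentially[OF cl _ this] c have "l - scale k b \<in> W"
      by simp
    then show "l \<in> {x. \<exists>c. x - scale c b \<in> W}" by blast
  qed
  moreover have "subspace {x. \<exists>c. x - scale c b \<in> W}"
  proof (rule subspaceI)
    show "0 \<in> {x. \<exists>c. x - scale c b \<in> W}"
      using subspace_0[OF sub] by (auto intro!: exI[of _ 0])
  next
    fix x y assume "x \<in> {x. \<exists>c. x - scale c b \<in> W}" "y \<in> {x. \<exists>c. x - scale c b \<in> W}"
    then obtain c k where "x - scale c b \<in> W" "y - scale k b \<in> W" by blast
    from subspace_add[OF sub this] show "x + y \<in> {x. \<exists>c. x - scale c b \<in> W}"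
      by (auto intro!: exI[of _ "c + k"] simp: scale_left_distrib add_diff_add)
  next
    fix a x assume "x \<in> {x. \<exists>c. x - scale c b \<in> W}"
    then obtain c where "x - scale c b \<in> W" by blast
    from subspace_scale[OF sub this, of a] show "scale a x \<in> {x. \<exists>c. x - scale c b \<in> W}"
      by (auto intro!: exI[of _ "a * c"] simp: scale_right_diff_distrib)
  qed
  ultimately show ?thesis by (simp add: closed_subspace_def)
qed

lemma closed_subspace_add_finite_span:
  assumes "closed_subspace W" "finite B"
  shows "closed_subspace {x. \<exists>c. x - (\<Sum>b\<in>B. scale (c b) b) \<in> W}"
  using assms(2)
proof induction
  case empty
  then show ?case using assms(1) by simp
next
  case (insert b B)
  have "{x. \<exists>c. x - (\<Sum>b\<in>insert b B. scale (c b) b) \<in> W} =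
      {x. \<exists>k. x - scale k b \<in> {x. \<exists>c. x - (\<Sum>b\<in>B. scale (c b) b) \<in> W}}"
  proof (intro Collect_cong iffI; clarsimp)
    fix x c assume "x - (\<Sum>b\<in>insert b B. scale (c b) b) \<in> W"
    then show "\<exists>k c. x - scale k b - (\<Sum>b\<in>B. scale (c b) b) \<in> W"
      using insert by (auto simp: algebra_simps intro!: exI[of _ "c b"] exI[of _ c])
  next
    fix x c k assume *: "x - scale k b - (\<Sum>b\<in>B. scale (c b) b) \<in> W"
    have "(\<Sum>a\<in>B. scale ((c(b := k)) a) a) = (\<Sum>a\<in>B. scale (c a) a)"
      using insert.hyps by (intro sum.cong) auto
    then have "(\<Sum>a\<in>insert b B. scale ((c(b := k)) a) a) = scale k b + (\<Sum>a\<in>B. scale (c a) a)"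
      using insert.hyps by (simp only: sum.insert fun_upd_same not_False_eq_True)
    then have "x - (\<Sum>a\<in>insert b B. scale ((c(b := k)) a) a) \<in> W"
      using * by (simp only: diff_diff_eq)
    then show "\<exists>c. x - (\<Sum>b\<in>insert b B. scale (c b) b) \<in> W"
      by blast
  qed
  then show ?case
    using closed_subspace_add_line[OF insert.IH] by simp
qed

end

text \<open>
  The functions \<open>q i\<close>, for \<open>i < n\<close>, are a basis of the annihilator of \<open>Y\<close> in the dual space, and the vectors
  \<open>e i\<close> are biorthogonal to them. Indexing by natural numbers makes the moment matrices below available
  as matrices of a size that is not fixed by a type.
\<close>

locale quotient_coordinates = banach_over scale
  for scale :: "'k::real_or_complex \<Rightarrow> 'a::banach \<Rightarrow> 'a" +
  fixes Y :: "'a set" and n :: nat and q :: "nat \<Rightarrow> 'a \<Rightarrow> 'k" and e :: "nat \<Rightarrow> 'a" and C :: real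
  assumes q_add: "i < n \<Longrightarrow> q i (x + y) = q i x + q i y"
    and q_scale: "i < n \<Longrightarrow> q i (scale c x) = c * q i x"
    and q_e: "i < n \<Longrightarrow> k < n \<Longrightarrow> q i (e k) = (if i = k then 1 else 0)"
    and norm_q_le: "i < n \<Longrightarrow> norm (q i x) \<le> C * norm x"
    and mem_Y_iff: "x \<in> Y \<longleftrightarrow> (\<forall>i<n. q i x = 0)"

text \<open>
  Linearity of the coefficients is forced by their uniqueness. The coefficient of \<open>b\<close> is bounded because
  \<open>Y\<close> together with the remaining basis vectors still spans a closed subspace, which does not contain \<open>b\<close>.
\<close>

lemma (in banach_over) quotient_coordinates_exist:
  assumes Y: "closed_subspace Y" and codim: "has_codim Y n"
  obtains q e C where "quotient_coordinates scale Y n q e C"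
proof -
  have sub: "subspace Y"
    using Y by (simp add: closed_subspace_def)
  obtain B where B: "finite B" "card B = n"
    and indep: "\<And>c. (\<Sum>b\<in>B. scale (c b) b) \<in> Y \<Longrightarrow> \<forall>b\<in>B. c b = 0"
    and spans: "\<And>x. \<exists>c. x - (\<Sum>b\<in>B. scale (c b) b) \<in> Y"
    using codim unfolding has_codim_def by blast
  obtain p where p: "\<And>x. x - (\<Sum>b\<in>B. scale (p x b) b) \<in> Y"
    using spans by metis
  have unique: "p x b = c b" if "x - (\<Sum>b\<in>B. scale (c b) b) \<in> Y" "b \<in> B" for x c b
  proof -
    have "(\<Sum>b\<in>B. scale (p x b - c b) b) =
        (x - (\<Sum>b\<in>B. scale (c b) b)) - (x - (\<Sum>b\<in>B. scale (p x b) b))"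
      by (simp add: scale_left_diff_distrib sum_subtractf)
    also have "\<dots> \<in> Y"
      by (rule subspace_diff[OF sub that(1) p])
    finally show ?thesis
      using indep[of "\<lambda>b. p x b - c b"] that(2) by simp
  qed
  have p_bounded: "\<exists>K. \<forall>x. norm (p x b) \<le> K * norm x" if b: "b \<in> B" for b
  proof -
    define W where "W = {x. \<exists>c. x - (\<Sum>b\<in>B - {b}. scale (c b) b) \<in> Y}"
    have W: "closed_subspace W"
      unfolding W_def using Y B(1) by (intro closed_subspace_add_finite_span) auto
    have "b \<notin> W"
    proof
      assume "b \<in> W"
      then obtain c where c: "b - (\<Sum>b\<in>B - {b}. scale (c b) b) \<in> Y"
        unfolding W_def by blast
      have "(\<Sum>a\<in>B. scale (if a = b then 1 else - c a) a) =
          b + (\<Sum>a\<in>B - {b}. scale (if a = b then 1 else - c a) a)"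
        using b B(1) by (simp add: sum.remove)
      also have "(\<Sum>a\<in>B - {b}. scale (if a = b then 1 else - c a) a) =
          (\<Sum>a\<in>B - {b}. - scale (c a) a)"
        by (intro sum.cong) auto
      finally have "(\<Sum>a\<in>B. scale (if a = b then 1 else - c a) a) \<in> Y"
        using c by (simp add: sum_negf)
      from indep[OF this] b show False by auto
    qed
    then obtain d where d: "d > 0" "\<And>w c. w \<in> W \<Longrightarrow> d * norm c \<le> norm (w + scale c b)"
      using norm_add_scale_ge[OF W] by blast
    have "norm (p x b) \<le> inverse d * norm x" for x
    proof -
      have "x - scale (p x b) b \<in> W"
        unfolding W_def using p[of x] b B(1)
        by (auto intro!: exI[of _ "p x"] simp: sum.remove algebra_simps)
      from d(2)[OF this, of "p x b"] d(1) show ?thesis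
        by (simp add: field_simps)
    qed
    then show ?thesis by blast
  qed
  then obtain K where K: "\<And>x b. b \<in> B \<Longrightarrow> norm (p x b) \<le> K b * norm x"
    by metis
  obtain e where e: "bij_betw e {0..<n} B"
    using ex_bij_betw_nat_finite[OF B(1)] B(2) by blast
  have eB: "e i \<in> B" if "i < n" for i
    using e that by (auto simp: bij_betw_def)
  have "quotient_coordinates scale Y n (\<lambda>i x. p x (e i)) e (\<Sum>b\<in>B. \<bar>K b\<bar>)"
  proof
    fix i x y assume i: "i < n"
    have "x + y - (\<Sum>b\<in>B. scale (p x b + p y b) b) \<in> Y"
      using subspace_add[OF sub p[of x] p[of y]]
      by (simp add: scale_left_distrib sum.distrib algebra_simps)
    then show "p (x + y) (e i) = p x (e i) + p y (e i)"
      using eB[OF i] by (rule unique)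
  next
    fix i c x assume i: "i < n"
    have "scale c x - (\<Sum>b\<in>B. scale (c * p x b) b) \<in> Y"
      using subspace_scale[OF sub p[of x], of c]
      by (simp add: scale_right_diff_distrib scale_sum_right)
    then show "p (scale c x) (e i) = c * p x (e i)"
      using eB[OF i] by (rule unique)
  next
    fix i k assume ik: "i < n" "k < n"
    have "e k - (\<Sum>b\<in>B. scale (if b = e k then 1 else 0) b) = 0"
      using eB[OF ik(2)] B(1) by (simp add: if_distrib[of "\<lambda>c. scale c _"] cong: if_cong)
    then have "p (e k) (e i) = (if e i = e k then 1 else 0)"
      using eB[OF ik(1)] subspace_0[OF sub] by (intro unique) auto
    then show "p (e k) (e i) = (if i = k then 1 else 0)"
      using e ik by (auto simp: bij_betw_def inj_on_def)
  next
    fix i x assume i: "i < n"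
    have "norm (p x (e i)) \<le> \<bar>K (e i)\<bar> * norm x"
      using K[OF eB[OF i], of x] by (smt (verit) mult_right_mono norm_ge_zero)
    also have "\<dots> \<le> (\<Sum>b\<in>B. \<bar>K b\<bar>) * norm x"
      using B(1) eB[OF i] by (intro mult_right_mono member_le_sum) auto
    finally show "norm (p x (e i)) \<le> (\<Sum>b\<in>B. \<bar>K b\<bar>) * norm x" .
  next
    fix x
    show "x \<in> Y \<longleftrightarrow> (\<forall>i<n. p x (e i) = 0)"
    proof
      assume "x \<in> Y"
      then show "\<forall>i<n. p x (e i) = 0"
        using unique[of x "\<lambda>_. 0"] eB by simp
    next
      assume "\<forall>i<n. p x (e i) = 0"
      then have "\<forall>b\<in>B. p x b = 0"
        using e by (auto simp: bij_betw_def)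
      then show "x \<in> Y" using p[of x] by simp
    qed
  qed
  then show ?thesis by (rule that)
qed

section \<open>Near-optimal designs\<close>

definition pairing :: "nat \<Rightarrow> (nat \<Rightarrow> 'k::real_or_complex) \<Rightarrow> (nat \<Rightarrow> 'k) \<Rightarrow> 'k" where
  "pairing n u v = (\<Sum>k<n. u k * conj_scalar (v k))"

text \<open>
  For \<open>u\<close> with values in the column vectors of length \<open>n\<close>, this is the entry of \<open>\<Sum>x. p(x) u(x) u(x)\<^sup>*\<close>. When
  \<open>p\<close> is a probability weight, this is the information matrix of an experimental design.
\<close>

definition moment :: "('b \<Rightarrow> nat \<Rightarrow> 'k::real_or_complex) \<Rightarrow> 'b set \<Rightarrow> ('b \<Rightarrow> real) \<Rightarrow> nat \<Rightarrow> nat \<Rightarrow> 'k" where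
  "moment u S p i k = (\<Sum>x\<in>S. of_real (p x) * (u x i * conj_scalar (u x k)))"

text \<open>
  A finitely supported probability measure on \<open>X\<close>. The weight is required to vanish off \<open>S\<close> so that
  mixing in a further point needs no case distinction on whether that point already lies in \<open>S\<close>.
\<close>

definition design :: "'b set \<Rightarrow> 'b set \<Rightarrow> ('b \<Rightarrow> real) \<Rightarrow> bool" where
  "design X S p \<longleftrightarrow> finite S \<and> S \<subseteq> X \<and> (\<forall>x. p x \<ge> 0) \<and> (\<forall>x. x \<notin> S \<longrightarrow> p x = 0) \<and> sum p S = 1"

lemma moment_apply:
  "(\<Sum>k<n. moment u S p i k * w k) = (\<Sum>x\<in>S. of_real (p x) * (pairing n w (u x) * u x i))"
proof -
  have "(\<Sum>k<n. moment u S p i k * w k) =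
      (\<Sum>k<n. \<Sum>x\<in>S. of_real (p x) * (u x i * conj_scalar (u x k)) * w k)"
    by (simp add: moment_def sum_distrib_right)
  also have "\<dots> = (\<Sum>x\<in>S. \<Sum>k<n. of_real (p x) * (u x i * conj_scalar (u x k)) * w k)"
    by (rule sum.swap)
  also have "\<dots> = (\<Sum>x\<in>S. of_real (p x) * (pairing n w (u x) * u x i))"
    by (simp add: pairing_def sum_distrib_left sum_distrib_right mult_ac)
  finally show ?thesis .
qed

text \<open>
  If \<open>M\<close> is the moment matrix and \<open>v = M w\<close>, then \<open>v\<^sup>* w = w\<^sup>* M w\<close>, since \<open>M\<close> is Hermitian; the quadratic
  form of \<open>M\<close> is a weighted sum of squares. So \<open>v\<^sup>* M\<^sup>-\<^sup>1 v\<close>, wherever it makes sense, is a nonnegative real.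
\<close>

lemma pairing_moment:
  assumes "\<And>i. i < n \<Longrightarrow> (\<Sum>k<n. moment u S p i k * w k) = v i"
  shows "pairing n w v = of_real (\<Sum>x\<in>S. p x * (norm (pairing n w (u x)))\<^sup>2)"
proof -
  have v: "v i = (\<Sum>x\<in>S. of_real (p x) * (pairing n w (u x) * u x i))" if "i < n" for i
    using assms[OF that] by (simp only: moment_apply)
  have "pairing n w v = (\<Sum>i<n. \<Sum>x\<in>S. w i * conj_scalar (of_real (p x) * (pairing n w (u x) * u x i)))"
    unfolding pairing_def[of n w v] by (intro sum.cong refl) (simp add: v conj_scalar_sum sum_distrib_left)
  also have "\<dots> = (\<Sum>x\<in>S. \<Sum>i<n. w i * conj_scalar (of_real (p x) * (pairing n w (u x) * u x i)))"
    by (rule sum.swap)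
  also have "\<dots> = (\<Sum>x\<in>S. of_real (p x) * (pairing n w (u x) * conj_scalar (pairing n w (u x))))"
  proof (rule sum.cong[OF refl])
    fix x
    have "(\<Sum>i<n. w i * conj_scalar (of_real (p x) * (pairing n w (u x) * u x i))) =
        of_real (p x) * (conj_scalar (pairing n w (u x)) * (\<Sum>i<n. w i * conj_scalar (u x i)))"
      by (simp add: conj_scalar_mult sum_distrib_left mult_ac)
    then show "(\<Sum>i<n. w i * conj_scalar (of_real (p x) * (pairing n w (u x) * u x i))) =
        of_real (p x) * (pairing n w (u x) * conj_scalar (pairing n w (u x)))"
      by (simp add: pairing_def mult_ac)
  qed
  also have "\<dots> = of_real (\<Sum>x\<in>S. p x * (norm (pairing n w (u x)))\<^sup>2)"
    by (simp add: mult_conj_scalar_self)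
  finally show ?thesis .
qed

abbreviation moment_det :: "nat \<Rightarrow> ('b \<Rightarrow> nat \<Rightarrow> 'k::real_or_complex) \<Rightarrow> 'b set \<Rightarrow> ('b \<Rightarrow> real) \<Rightarrow> 'k" where
  "moment_det n u S p \<equiv> Determinant.det (mat n n (\<lambda>(i, k). moment u S p i k))"

lemma norm_moment_le:
  assumes d: "design X S p" and bound: "\<And>x. x \<in> X \<Longrightarrow> norm (u x i) \<le> C" "\<And>x. x \<in> X \<Longrightarrow> norm (u x k) \<le> C"
  shows "norm (moment u S p i k) \<le> C\<^sup>2"
proof -
  have "norm (moment u S p i k) \<le> (\<Sum>x\<in>S. norm (of_real (p x) * (u x i * conj_scalar (u x k))))"
    unfolding moment_def by (rule norm_sum)
  also have "\<dots> \<le> (\<Sum>x\<in>S. p x * C\<^sup>2)"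
  proof (rule sum_mono)
    fix x assume "x \<in> S"
    then have "x \<in> X" using d by (auto simp: design_def)
    then have "norm (u x i) * norm (u x k) \<le> C * C"
      using bound by (intro mult_mono) (auto intro: order_trans[OF norm_ge_zero])
    then show "norm (of_real (p x) * (u x i * conj_scalar (u x k))) \<le> p x * C\<^sup>2"
      using d by (auto simp: design_def norm_mult power2_eq_square intro!: mult_left_mono)
  qed
  also have "\<dots> = C\<^sup>2"
    using d by (simp add: design_def flip: sum_distrib_right)
  finally show ?thesis .
qed

lemma design_add_point:
  assumes d: "design X S p" and y: "y \<in> X" and t: "0 \<le> t" "t \<le> 1"
  defines "p' \<equiv> (\<lambda>x. (1 - t) * p x + (if x = y then t else 0))"
  shows "design X (insert y S) p'"
    and "moment u (insert y S) p' i k =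
      of_real (1 - t) * moment u S p i k + of_real t * (u y i * conj_scalar (u y k))"
proof -
  have S: "finite S" and p: "p x \<ge> 0" "x \<notin> S \<Longrightarrow> p x = 0" for x
    using d by (auto simp: design_def)
  have supp: "(\<Sum>x\<in>insert y S. g x) = (\<Sum>x\<in>S. g x)" if "\<And>x. x \<notin> S \<Longrightarrow> g x = 0"
    for g :: "'a \<Rightarrow> 'c::comm_monoid_add"
    using S that by (intro sum.mono_neutral_right) auto
  have "sum p (insert y S) = sum p S"
    by (rule supp) (rule p(2))
  then have "sum p' (insert y S) = (1 - t) * sum p S + t"
    unfolding p'_def by (simp only: sum.distrib sum_distrib_left[symmetric]) (simp add: S)
  then show "design X (insert y S) p'"
    using d y t by (auto simp: design_def p'_def)
  have "moment u (insert y S) p' i k =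
      (\<Sum>x\<in>insert y S. of_real (1 - t) * (of_real (p x) * (u x i * conj_scalar (u x k))) +
        (if x = y then of_real t * (u x i * conj_scalar (u x k)) else 0))"
    unfolding moment_def p'_def by (intro sum.cong refl) (auto simp: algebra_simps)
  also have "\<dots> = of_real (1 - t) * moment u (insert y S) p i k + of_real t * (u y i * conj_scalar (u y k))"
    unfolding moment_def by (simp only: sum.distrib sum_distrib_left[symmetric]) (simp add: S)
  also have "moment u (insert y S) p i k = moment u S p i k"
    unfolding moment_def using p by (intro supp) simp
  finally show "moment u (insert y S) p' i k =
      of_real (1 - t) * moment u S p i k + of_real t * (u y i * conj_scalar (u y k))" .
qed

text \<open>
  Shifting mass \<open>t\<close> to the point \<open>y\<close> scales the moment matrix by \<open>1 - t\<close> and adds a matrix of rank one,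
  so the matrix determinant lemma gives the exact change of the determinant.
\<close>

lemma moment_det_add_point:
  fixes u :: "'b \<Rightarrow> nat \<Rightarrow> 'k::real_or_complex"
  assumes d: "design X S p" and y: "y \<in> X" and t: "0 \<le> t" "t < 1"
    and w: "\<And>i. i < n \<Longrightarrow> (\<Sum>k<n. moment u S p i k * w k) = u y i"
  defines "a \<equiv> (\<Sum>x\<in>S. p x * (norm (pairing n w (u x)))\<^sup>2)"
  shows "norm (moment_det n u (insert y S) (\<lambda>x. (1 - t) * p x + (if x = y then t else 0))) =
    (1 - t) ^ n * (1 + t / (1 - t) * a) * norm (moment_det n u S p)"
proof -
  let ?s = "t / (1 - t)"
  have a: "a \<ge> 0"
    unfolding a_def using d by (auto simp: design_def intro!: sum_nonneg)
  have "moment u (insert y S) (\<lambda>x. (1 - t) * p x + (if x = y then t else 0)) i k =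
      of_real (1 - t) * (moment u S p i k + u y i * (of_real ?s * conj_scalar (u y k)))" for i k
  proof -
    have "moment u (insert y S) (\<lambda>x. (1 - t) * p x + (if x = y then t else 0)) i k =
        of_real (1 - t) * moment u S p i k + of_real t * (u y i * conj_scalar (u y k))"
      using t by (intro design_add_point(2)[OF d y]) auto
    also have "(of_real t :: 'k) = of_real ((1 - t) * ?s)"
      using t by simp
    finally show ?thesis
      by (simp only: of_real_mult distrib_left mult_ac)
  qed
  then have "moment_det n u (insert y S) (\<lambda>x. (1 - t) * p x + (if x = y then t else 0)) =
      of_real (1 - t) ^ n *
      Determinant.det (mat n n (\<lambda>(i, k). moment u S p i k + u y i * (of_real ?s * conj_scalar (u y k))))"
    by (simp only: det_const_mult)
  also have "Determinant.det (mat n n (\<lambda>(i, k). moment u S p i k + u y i * (of_real ?s * conj_scalar (u y k)))) =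
      moment_det n u S p * (1 + (\<Sum>k<n. of_real ?s * conj_scalar (u y k) * w k))"
    by (rule det_rank_one_update) (rule w)
  also have "(\<Sum>k<n. of_real ?s * conj_scalar (u y k) * w k) = of_real ?s * pairing n w (u y)"
    by (simp add: pairing_def sum_distrib_left mult_ac)
  also have "pairing n w (u y) = of_real a"
    unfolding a_def by (rule pairing_moment) (rule w)
  also have "1 + of_real ?s * of_real a = (of_real (1 + ?s * a) :: 'k)"
    by simp
  finally have "norm (moment_det n u (insert y S) (\<lambda>x. (1 - t) * p x + (if x = y then t else 0))) =
      \<bar>1 - t\<bar> ^ n * (norm (moment_det n u S p) * \<bar>1 + ?s * a\<bar>)"
    by (simp only: norm_mult norm_power norm_of_real)
  moreover have "0 \<le> ?s * a"
    using t a by simp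
  ultimately show ?thesis
    using t by simp
qed

text \<open>
  The left-hand side of the hypothesis on \<open>a\<close> is \<open>1 + t (a - n)\<close> up to terms of order \<open>t\<^sup>2\<close>. For small \<open>t\<close>, a gain of at
  most \<open>\<delta>\<close>, with \<open>\<delta>\<close> much smaller than \<open>t\<close>, therefore keeps \<open>a\<close> from exceeding \<open>n\<close> noticeably.
\<close>

lemma near_optimal_gain_bound:
  fixes \<epsilon> :: real
  assumes n: "n \<ge> 1" and \<epsilon>: "\<epsilon> > 0"
  obtains t \<delta> where "0 < t" "t < 1" "\<delta> > 0"
    "\<And>a. (1 - t) ^ n * (1 + t / (1 - t) * a) \<le> 1 + \<delta> \<Longrightarrow> a \<le> real n + \<epsilon>"
proof -
  \<comment> \<open>The coefficient of the quadratic error term at \<open>a = n + \<epsilon>\<close>.\<close>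
  define L where "L = (real n - 1) * (real n + \<epsilon> - 1)"
  have L: "L \<ge> 0"
    unfolding L_def using n \<epsilon> by (intro mult_nonneg_nonneg) auto
  define t where "t = min (1/2) (\<epsilon> / (2 * (L + 1)))"
  define \<delta> where "\<delta> = t * \<epsilon> / 4"
  have t: "0 < t" "t < 1"
    unfolding t_def using \<epsilon> L by auto
  have "t * L \<le> \<epsilon> / (2 * (L + 1)) * L"
    unfolding t_def using L by (intro mult_right_mono) auto
  also have "\<dots> \<le> \<epsilon> / 2"
    using L \<epsilon> by (simp add: field_simps)
  finally have tL: "t * L \<le> \<epsilon> / 2" .
  have "a \<le> real n + \<epsilon>" if a: "(1 - t) ^ n * (1 + t / (1 - t) * a) \<le> 1 + \<delta>" for a
  proof (rule ccontr)
    assume "\<not> a \<le> real n + \<epsilon>"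
    then have na: "real n + \<epsilon> - 1 \<le> a - 1" by simp
    have "1 + real (n - 1) * (- t) \<le> (1 + (- t)) ^ (n - 1)"
      using t by (intro Bernoulli_inequality) auto
    then have B: "1 - (real n - 1) * t \<le> (1 - t) ^ (n - 1)"
      using n by (simp add: of_nat_diff)
    have "1 + t * \<epsilon> - t * (t * L) = (1 - (real n - 1) * t) * (1 + t * (real n + \<epsilon> - 1))"
      unfolding L_def by (simp add: algebra_simps)
    also have "\<dots> \<le> (1 - t) ^ (n - 1) * (1 + t * (a - 1))"
      using B na t \<epsilon> n by (intro mult_mono add_left_mono mult_left_mono) auto
    also have "1 + t * (a - 1) = (1 - t) * (1 + t / (1 - t) * a)"
      using t by (simp add: field_simps)
    also have "(1 - t) ^ (n - 1) * \<dots> = (1 - t) ^ n * (1 + t / (1 - t) * a)"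
      using n by (cases n) simp_all
    also note a
    finally have "t * \<epsilon> - t * (t * L) \<le> \<delta>" by simp
    moreover have "t * (t * L) \<le> t * (\<epsilon> / 2)"
      using t tL by (intro mult_left_mono) auto
    moreover have "t * \<epsilon> > 0"
      using t \<epsilon> by simp
    ultimately show False
      unfolding \<delta>_def by (simp add: field_simps)
  qed
  moreover have "\<delta> > 0"
    unfolding \<delta>_def using t \<epsilon> by simp
  ultimately show ?thesis
    using t that by blast
qed

text \<open>
  This is the equivalence theorem of Kiefer and Wolfowitz in an approximate form. For a design whose
  determinant is within a factor \<open>1 + \<delta>\<close> of the supremum, no shift of mass to a point \<open>y\<close> can gain more
  than this factor; with \<open>w = M\<^sup>-\<^sup>1 u(y)\<close>, this bounds the energy \<open>u(y)\<^sup>* M\<^sup>-\<^sup>1 u(y)\<close>, which is the sum in the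
  conclusion. Near-optimality suffices for the projection constant, since that is an infimum, and it is
  available without any compactness of the set of designs.
\<close>

lemma near_optimal_design_exists:
  fixes u :: "'b \<Rightarrow> nat \<Rightarrow> 'k::real_or_complex"
  assumes n: "n \<ge> 1" and \<epsilon>: "\<epsilon> > 0"
    and bound: "\<And>x i. x \<in> X \<Longrightarrow> i < n \<Longrightarrow> norm (u x i) \<le> C"
    and nondegenerate: "\<exists>S p. design X S p \<and> moment_det n u S p \<noteq> 0"
  obtains S p where "design X S p" "moment_det n u S p \<noteq> 0"
    "\<And>y w. y \<in> X \<Longrightarrow> (\<And>i. i < n \<Longrightarrow> (\<Sum>k<n. moment u S p i k * w k) = u y i) \<Longrightarrow>
      (\<Sum>x\<in>S. p x * (norm (pairing n w (u x)))\<^sup>2) \<le> real n + \<epsilon>"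
proof -
  obtain t \<delta> where t: "0 < t" "t < 1" and \<delta>: "\<delta> > 0"
    and gain: "\<And>a. (1 - t) ^ n * (1 + t / (1 - t) * a) \<le> 1 + \<delta> \<Longrightarrow> a \<le> real n + \<epsilon>"
    using near_optimal_gain_bound[OF n \<epsilon>] by blast
  define V where "V = {norm (moment_det n u S p) | S p. design X S p}"
  have "v \<le> fact n * (C\<^sup>2) ^ n" if "v \<in> V" for v
    using that unfolding V_def by (auto intro!: norm_det_le norm_moment_le bound)
  then have bdd: "bdd_above V" by (rule bdd_aboveI)
  obtain S0 p0 where 0: "design X S0 p0" "moment_det n u S0 p0 \<noteq> 0"
    using nondegenerate by blast
  have "norm (moment_det n u S0 p0) \<in> V"
    unfolding V_def using 0 by blast
  then have pos: "0 < Sup V" "V \<noteq> {}"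
    using cSup_upper[OF _ bdd] 0(2) by (force intro: less_le_trans[of 0 "norm (moment_det n u S0 p0)"])+
  then have "Sup V / (1 + \<delta>) < Sup V"
    using \<delta> by (simp add: field_simps)
  then obtain S p where d: "design X S p" and Sp: "Sup V / (1 + \<delta>) < norm (moment_det n u S p)"
    using less_cSup_iff[OF pos(2) bdd] unfolding V_def by blast
  have "0 \<le> Sup V / (1 + \<delta>)" using pos \<delta> by simp
  with Sp have nz: "0 < norm (moment_det n u S p)" by linarith
  have "(\<Sum>x\<in>S. p x * (norm (pairing n w (u x)))\<^sup>2) \<le> real n + \<epsilon>"
    if y: "y \<in> X" and w: "\<And>i. i < n \<Longrightarrow> (\<Sum>k<n. moment u S p i k * w k) = u y i" for y w
  proof (rule gain)
    let ?a = "\<Sum>x\<in>S. p x * (norm (pairing n w (u x)))\<^sup>2"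
    let ?p = "\<lambda>x. (1 - t) * p x + (if x = y then t else 0)"
    have "norm (moment_det n u (insert y S) ?p) \<in> V"
      unfolding V_def using design_add_point(1)[OF d y, of t] t by auto
    then have "norm (moment_det n u (insert y S) ?p) \<le> Sup V"
      by (rule cSup_upper[OF _ bdd])
    also have "\<dots> \<le> (1 + \<delta>) * norm (moment_det n u S p)"
      using Sp \<delta> by (simp add: field_simps)
    finally show "(1 - t) ^ n * (1 + t / (1 - t) * ?a) \<le> 1 + \<delta>"
      using moment_det_add_point[OF d y _ t(2) w] t nz by simp
  qed
  then show ?thesis
    using d nz that by fastforce
qed

text \<open>
  The variance \<open>\<Sum>x. p(x) (a(x) - m)\<^sup>2\<close> about the mean \<open>m\<close> is nonnegative.
\<close>

lemma weighted_mean_le_root_mean_square: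
  fixes p a :: "'b \<Rightarrow> real"
  assumes "\<And>x. x \<in> S \<Longrightarrow> p x \<ge> 0" "sum p S = 1"
  shows "(\<Sum>x\<in>S. p x * a x) \<le> sqrt (\<Sum>x\<in>S. p x * (a x)\<^sup>2)"
proof -
  let ?m = "\<Sum>x\<in>S. p x * a x"
  have "0 \<le> (\<Sum>x\<in>S. p x * (a x - ?m)\<^sup>2)"
    using assms(1) by (intro sum_nonneg) auto
  also have "\<dots> = (\<Sum>x\<in>S. p x * (a x)\<^sup>2 - 2 * ?m * (p x * a x) + ?m\<^sup>2 * p x)"
    by (intro sum.cong) (simp_all add: power2_diff algebra_simps)
  also have "\<dots> = (\<Sum>x\<in>S. p x * (a x)\<^sup>2) - 2 * ?m * ?m + ?m\<^sup>2 * sum p S"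
    by (simp only: sum.distrib sum_subtractf sum_distrib_left)
  also have "\<dots> = (\<Sum>x\<in>S. p x * (a x)\<^sup>2) - ?m\<^sup>2"
    using assms(2) by (simp add: power2_eq_square)
  finally show ?thesis
    by (intro real_le_rsqrt) simp
qed

section \<open>Projections of norm close to the upper bound\<close>

context banach_over
begin

lemma bounded_operatorI:
  assumes "\<And>x y. T (x + y) = T x + T y" "\<And>c x. T (scale c x) = scale c (T x)"
    and "\<And>x. norm (T x) \<le> K * norm x"
  shows "bounded_operator T"
proof -
  have "Vector_Spaces.linear scale scale T"
    using assms(1,2) by unfold_locales
  moreover have "bounded_linear T"
    using assms(1) assms(2)[of "of_real _"] assms(3)
    by (intro bounded_linear_intro[of T K]) (simp_all add: scale_of_real mult.commute)
  ultimately show ?thesis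
    by (simp add: bounded_operator_def)
qed

end

context quotient_coordinates
begin

lemma q_scaleR: "i < n \<Longrightarrow> q i (r *\<^sub>R x) = of_real r * q i x"
  using q_scale[of i "of_real r" x] by (simp add: scale_of_real)

lemma q_0: "i < n \<Longrightarrow> q i 0 = 0"
  using q_scaleR[of i 0 0] by simp

lemma q_minus: "i < n \<Longrightarrow> q i (- x) = - q i x"
  using q_scaleR[of i "-1" x] by simp

lemma q_diff: "i < n \<Longrightarrow> q i (x - y) = q i x - q i y"
  using q_add[of i x "- y"] by (simp add: q_minus)

lemma q_sum: "i < n \<Longrightarrow> q i (\<Sum>x\<in>A. f x) = (\<Sum>x\<in>A. q i (f x))"
  by (induction A rule: infinite_finite_induct) (simp_all add: q_0 q_add)

text \<open>
  The uniform design on the normalised vectors \<open>e i\<close>, whose moment matrix is diagonal.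
\<close>

lemma nondegenerate_design_exists:
  assumes n: "n \<ge> 1"
  shows "\<exists>S p. design (cball 0 1) S p \<and> moment_det n (\<lambda>x i. q i x) S p \<noteq> 0"
proof -
  define c where "c k = inverse (norm (e k))" for k
  define a where "a k = c k *\<^sub>R e k" for k
  define S where "S = a ` {..<n}"
  define p where "p x = (if x \<in> S then 1 / real n else 0)" for x
  have e_nz: "e k \<noteq> 0" if "k < n" for k
    using q_e[OF that that] q_0[OF that] by auto
  then have c_nz: "c k \<noteq> 0" if "k < n" for k
    using that by (simp add: c_def)
  have q_a: "q i (a k) = (if i = k then of_real (c k) else 0)" if "i < n" "k < n" for i k
    using that by (simp add: a_def q_scaleR q_e)
  have inj: "inj_on a {..<n}"
  proof (rule inj_onI)
    fix i k assume ik: "i \<in> {..<n}" "k \<in> {..<n}" "a i = a k"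
    show "i = k"
    proof (rule ccontr)
      assume "i \<noteq> k"
      then have "q i (a k) = 0"
        using q_a[of i k] ik by simp
      moreover have "q i (a i) = of_real (c i)"
        using q_a[of i i] ik by simp
      ultimately show False
        using ik c_nz[of i] by simp
    qed
  qed
  have "sum p S = (\<Sum>x\<in>S. 1 / real n)"
    unfolding p_def by (intro sum.cong) auto
  also have "\<dots> = 1"
    using n inj by (simp add: S_def card_image)
  finally have "design (cball 0 1) S p"
    using e_nz by (auto simp: design_def p_def S_def a_def c_def)
  moreover have "moment (\<lambda>x i. q i x) S p i k =
      (if i = k then of_real (1 / real n * (c i)\<^sup>2) else 0)" if ik: "i < n" "k < n" for i k
  proof -
    have "moment (\<lambda>x i. q i x) S p i k =
        (\<Sum>j<n. of_real (p (a j)) * (q i (a j) * conj_scalar (q k (a j))))"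
      unfolding moment_def S_def using inj by (simp add: sum.reindex)
    also have "\<dots> = (\<Sum>j<n. if j = i then (if i = k then of_real (1 / real n * (c i)\<^sup>2) else 0) else 0)"
      using ik by (intro sum.cong refl) (auto simp: q_a p_def S_def power2_eq_square)
    also have "\<dots> = (if i = k then of_real (1 / real n * (c i)\<^sup>2) else 0)"
      using ik by simp
    finally show ?thesis .
  qed
  then have "mat n n (\<lambda>(i, k). moment (\<lambda>x i. q i x) S p i k) =
      mat n n (\<lambda>(i, k). if i = k then of_real (1 / real n * (c i)\<^sup>2) else 0)"
    by (intro eq_matI) auto
  then have "moment_det n (\<lambda>x i. q i x) S p = (\<Prod>i<n. of_real (1 / real n * (c i)\<^sup>2))"
    by (simp only: det_diagonal)
  moreover have "\<dots> \<noteq> 0"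
    using n c_nz by auto
  ultimately show ?thesis by metis
qed

text \<open>
  Let \<open>M\<close> be the moment matrix of the design, and write \<open>q(y)\<close> for the column of coordinates of \<open>y\<close>. The
  operator \<open>Q y = \<Sum>x. p(x) (q(x)\<^sup>* M\<^sup>-\<^sup>1 q(y)) x\<close> satisfies \<open>q(Q y) = M M\<^sup>-\<^sup>1 q(y) = q(y)\<close>, and it vanishes on \<open>Y\<close>, so
  \<open>y - Q y\<close> defines a projection onto \<open>Y\<close>. As the points \<open>x\<close> lie in the unit ball, the norm of \<open>Q y\<close> is at
  most the mean of the moduli of its coefficients, which is at most their root mean square, and the
  square of the latter is the energy \<open>q(y)\<^sup>* M\<^sup>-\<^sup>1 q(y)\<close>.
\<close>

lemma projection_from_design:
  assumes d: "design (cball 0 1) S p"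
    and nz: "moment_det n (\<lambda>x i. q i x) S p \<noteq> 0"
    and energy: "\<And>y w. norm y \<le> 1 \<Longrightarrow>
      (\<And>i. i < n \<Longrightarrow> (\<Sum>k<n. moment (\<lambda>x i. q i x) S p i k * w k) = q i y) \<Longrightarrow>
      (\<Sum>x\<in>S. p x * (norm (pairing n w (\<lambda>i. q i x)))\<^sup>2) \<le> K"
  shows "\<exists>P\<in>projections_onto Y. onorm P \<le> 1 + sqrt K"
proof -
  let ?u = "\<lambda>x i. q i x"
  have S: "finite S" "\<And>x. x \<in> S \<Longrightarrow> norm x \<le> 1" and p: "\<And>x. p x \<ge> 0" "sum p S = 1"
    using d by (auto simp: design_def)
  obtain N where N: "\<And>i k. i < n \<Longrightarrow> k < n \<Longrightarrow> (\<Sum>l<n. moment ?u S p i l * N l k) = (if i = k then 1 else 0)"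
    using right_inverse_of_det_nonzero[OF nz] by blast
  \<comment> \<open>\<open>w y\<close> is \<open>M\<^sup>-\<^sup>1 q(y)\<close>.\<close>
  define w where "w y l = (\<Sum>k<n. N l k * q k y)" for y l
  have w: "(\<Sum>l<n. moment ?u S p i l * w y l) = q i y" if i: "i < n" for i y
  proof -
    have "(\<Sum>l<n. moment ?u S p i l * w y l) = (\<Sum>l<n. \<Sum>k<n. moment ?u S p i l * N l k * q k y)"
      by (simp add: w_def sum_distrib_left mult.assoc)
    also have "\<dots> = (\<Sum>k<n. (\<Sum>l<n. moment ?u S p i l * N l k) * q k y)"
      by (subst sum.swap) (simp add: sum_distrib_right)
    also have "\<dots> = (\<Sum>k<n. if k = i then q i y else 0)"
      using i by (intro sum.cong refl) (auto simp: N)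
    finally show ?thesis using i by simp
  qed
  have w_add: "w (x + y) l = w x l + w y l" for x y l
    unfolding w_def by (simp add: q_add distrib_left flip: sum.distrib)
  have w_scale: "w (scale c y) l = c * w y l" for c y l
    unfolding w_def by (simp add: q_scale sum_distrib_left mult_ac)
  define Q where "Q y = (\<Sum>x\<in>S. scale (of_real (p x) * pairing n (w y) (?u x)) x)" for y
  have pair_add: "pairing n (w (x + y)) v = pairing n (w x) v + pairing n (w y) v" for x y v
    by (simp add: pairing_def w_add distrib_right sum.distrib)
  have pair_scale: "pairing n (w (scale c y)) v = c * pairing n (w y) v" for c y v
    by (simp add: pairing_def w_scale sum_distrib_left mult_ac)
  have Q_add: "Q (x + y) = Q x + Q y" for x y
    by (simp add: Q_def pair_add distrib_left scale_left_distrib sum.distrib)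
  have Q_scale: "Q (scale c y) = scale c (Q y)" for c y
    by (simp add: Q_def pair_scale scale_sum_right mult_ac)
  have q_Q: "q i (Q y) = q i y" if i: "i < n" for i y
  proof -
    have "q i (Q y) = (\<Sum>x\<in>S. of_real (p x) * (pairing n (w y) (?u x) * q i x))"
      using i by (simp add: Q_def q_sum q_scale mult.assoc)
    also have "\<dots> = (\<Sum>l<n. moment ?u S p i l * w y l)"
      by (simp add: moment_apply)
    finally show ?thesis using w[OF i] by simp
  qed
  have Q_ball: "norm (Q y) \<le> sqrt K" if y: "norm y \<le> 1" for y
  proof -
    have "norm (Q y) \<le> (\<Sum>x\<in>S. p x * norm (pairing n (w y) (?u x)))"
      unfolding Q_def
    proof (rule sum_norm_le)
      fix x assume "x \<in> S"
      then have "p x * norm (pairing n (w y) (?u x)) * norm x \<le> p x * norm (pairing n (w y) (?u x)) * 1"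
        using S p by (intro mult_left_mono) auto
      then show "norm (scale (of_real (p x) * pairing n (w y) (?u x)) x) \<le> p x * norm (pairing n (w y) (?u x))"
        using p by (simp add: norm_scale norm_mult)
    qed
    also have "\<dots> \<le> sqrt (\<Sum>x\<in>S. p x * (norm (pairing n (w y) (?u x)))\<^sup>2)"
      using p by (intro weighted_mean_le_root_mean_square) auto
    also have "\<dots> \<le> sqrt K"
      using energy[OF y, of "w y"] w by simp
    finally show ?thesis .
  qed
  have Q_scaleR: "Q (r *\<^sub>R y) = r *\<^sub>R Q y" for r y
    using Q_scale[of "of_real r" y] by (simp add: scale_of_real)
  have Q_le: "norm (Q y) \<le> sqrt K * norm y" for y
  proof (cases "y = 0")
    case True
    then show ?thesis using Q_scaleR[of 0 y] by simp
  next
    case False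
    then have "norm (Q (inverse (norm y) *\<^sub>R y)) \<le> sqrt K"
      by (intro Q_ball) simp
    then show ?thesis
      using False by (simp add: Q_scaleR field_simps)
  qed
  have P_le: "norm (y - Q y) \<le> (1 + sqrt K) * norm y" for y
    using norm_triangle_ineq4[of y "Q y"] Q_le[of y] by (simp add: distrib_right)
  have "bounded_operator (\<lambda>y. y - Q y)"
    by (rule bounded_operatorI[of _ "1 + sqrt K"])
      (simp_all add: Q_add Q_scale scale_right_diff_distrib P_le)
  moreover have "y - Q y \<in> Y" for y
    by (simp add: mem_Y_iff q_diff q_Q)
  moreover have "y - Q y = y" if "y \<in> Y" for y
    using that by (simp add: Q_def w_def pairing_def mem_Y_iff)
  ultimately have "(\<lambda>y. y - Q y) \<in> projections_onto Y"
    by (auto simp: projections_onto_def)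
  moreover have "0 \<le> sqrt K"
    using Q_ball[of 0] by (smt (verit) norm_ge_zero norm_zero)
  then have "onorm (\<lambda>y. y - Q y) \<le> 1 + sqrt K"
    by (intro onorm_bound P_le) simp
  ultimately show ?thesis by blast
qed

lemma projection_constant_le:
  assumes n: "n \<ge> 1"
  shows "projection_constant Y \<le> ereal (1 + sqrt (real n))"
proof (rule ereal_le_epsilon2)
  fix \<epsilon> :: real assume \<epsilon>: "\<epsilon> > 0"
  have "norm (q i x) \<le> \<bar>C\<bar>" if "x \<in> cball 0 1" "i < n" for x i
  proof -
    have "C * norm x \<le> \<bar>C\<bar> * 1"
      using that by (intro mult_mono) auto
    with norm_q_le[OF that(2), of x] show ?thesis by simp
  qed
  from near_optimal_design_exists[OF n, of "\<epsilon>\<^sup>2" "cball 0 1" "\<lambda>x i. q i x",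
      OF _ this nondegenerate_design_exists[OF n]] \<epsilon>
  obtain S p where "design (cball 0 1) S p" "moment_det n (\<lambda>x i. q i x) S p \<noteq> 0"
    "\<And>y w. y \<in> cball 0 1 \<Longrightarrow>
      (\<And>i. i < n \<Longrightarrow> (\<Sum>k<n. moment (\<lambda>x i. q i x) S p i k * w k) = q i y) \<Longrightarrow>
      (\<Sum>x\<in>S. p x * (norm (pairing n w (\<lambda>i. q i x)))\<^sup>2) \<le> real n + \<epsilon>\<^sup>2"
    by (auto simp del: mem_cball_0)
  then obtain P where P: "P \<in> projections_onto Y" "onorm P \<le> 1 + sqrt (real n + \<epsilon>\<^sup>2)"
    using projection_from_design[of S p "real n + \<epsilon>\<^sup>2"] by auto
  have "projection_constant Y \<le> ereal (onorm P)"
    unfolding projection_constant_def using P(1) by (rule INF_lower)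
  also have "\<dots> \<le> ereal (1 + sqrt (real n) + \<epsilon>)"
    using P(2) sqrt_add_le_add_sqrt[of "real n" "\<epsilon>\<^sup>2"] \<epsilon> by simp
  finally show "projection_constant Y \<le> ereal (1 + sqrt (real n)) + ereal \<epsilon>"
    by simp
qed

end

section \<open>The Daugavet property and the lower bound\<close>

abbreviation l2_norm :: "nat \<Rightarrow> (nat \<Rightarrow> 'k::real_or_complex) \<Rightarrow> real" where
  "l2_norm n u \<equiv> L2_set (\<lambda>i. norm (u i)) {..<n}"

lemma pairing_self: "pairing n u u = of_real ((l2_norm n u)\<^sup>2)"
  by (simp add: pairing_def mult_conj_scalar_self L2_set_def sum_nonneg)

lemma norm_pairing_le: "norm (pairing n u v) \<le> l2_norm n u * l2_norm n v"
proof -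
  have "norm (pairing n u v) \<le> (\<Sum>i<n. \<bar>norm (u i)\<bar> * \<bar>norm (v i)\<bar>)"
    unfolding pairing_def by (rule sum_norm_le) (simp add: norm_mult)
  also have "\<dots> \<le> l2_norm n u * l2_norm n v"
    by (rule L2_set_mult_ineq)
  finally show ?thesis .
qed

lemma l2_norm_diff_squared:
  "(l2_norm n (\<lambda>i. u i - v i))\<^sup>2 = (l2_norm n u)\<^sup>2 + (l2_norm n v)\<^sup>2 - 2 * Re (to_complex (pairing n u v))"
proof -
  have "(norm (a - b))\<^sup>2 = (norm a)\<^sup>2 + (norm b)\<^sup>2 - 2 * Re (to_complex (a * conj_scalar b))" for a b :: 'a
  proof -
    have "(cmod (to_complex a - to_complex b))\<^sup>2 =
        (cmod (to_complex a))\<^sup>2 + (cmod (to_complex b))\<^sup>2 - 2 * Re (to_complex a * cnj (to_complex b))"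
      by (simp add: cmod_power2) (simp add: power2_eq_square algebra_simps)
    then show ?thesis
      by (simp add: norm_to_complex to_complex_mult flip: to_complex_diff)
  qed
  moreover have "(l2_norm n w)\<^sup>2 = (\<Sum>i<n. (norm (w i))\<^sup>2)" for w :: "nat \<Rightarrow> 'a"
    by (simp add: L2_set_def sum_nonneg)
  ultimately show ?thesis
    by (simp only: pairing_def to_complex_sum Re_sum sum.distrib sum_subtractf sum_distrib_left)
qed

text \<open>
  Apply the Daugavet property to \<open>T x = - f(x) x0\<close>, whose norm is at least \<open>(1 - \<delta>) \<parallel>x0\<parallel>\<close>. A unit vector \<open>y\<close>
  almost attaining the norm of \<open>Id + T\<close>, rotated by a scalar of modulus one so that \<open>f(y) = s\<close> is a
  nonnegative real, satisfies \<open>\<parallel>y - s x0\<parallel> > 1 + (1 - 2 \<delta>) \<parallel>x0\<parallel>\<close>. This forces \<open>s \<ge> 1 - 2 \<delta>\<close>, and then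
  \<open>s x0\<close> may be replaced by \<open>x0\<close> at the cost of a further \<open>2 \<delta> \<parallel>x0\<parallel>\<close>. So every slice of the unit ball
  contains points almost as far as possible from a given vector.
\<close>

lemma (in banach_over) daugavet_slice:
  fixes f :: "'a \<Rightarrow> 'k"
  assumes D: "daugavet_property"
    and f_add: "\<And>x y. f (x + y) = f x + f y" and f_scale: "\<And>c x. f (scale c x) = c * f x"
    and f_le: "\<And>x. norm (f x) \<le> norm x"
    and \<delta>: "0 < \<delta>" "\<delta> \<le> 1 / 4"
    and x1: "norm x1 \<le> 1" "1 - \<delta> \<le> norm (f x1)"
    and x0: "x0 \<noteq> 0"
  obtains y s where "norm y \<le> 1" "f y = of_real s" "1 - 2 * \<delta> \<le> s"
    "1 + norm x0 - 4 * \<delta> * norm x0 \<le> norm (y - x0)"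
proof -
  define T where "T x = - scale (f x) x0" for x
  have T_scale: "T (scale c x) = scale c (T x)" for c x
    by (simp add: T_def f_scale)
  have norm_T: "norm (T x) = norm (f x) * norm x0" for x
    by (simp add: T_def norm_scale)
  have T: "bounded_operator T"
  proof (rule bounded_operatorI[of _ "norm x0"])
    show "T (x + y) = T x + T y" for x y
      by (simp add: T_def f_add scale_left_distrib)
    show "norm (T x) \<le> norm x0 * norm x" for x
      using mult_right_mono[OF f_le norm_ge_zero[of x0], of x] by (simp add: norm_T mult.commute)
  qed (rule T_scale)
  then have lin: "bounded_linear T"
    by (simp add: bounded_operator_def)
  have fx1: "f x1 \<noteq> 0"
    using x1 \<delta> by auto
  have "range T = span {x0}"
  proof
    show "range T \<subseteq> span {x0}"
      by (auto simp: T_def span_singleton simp flip: scale_minus_left)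
    have "scale k x0 = T (scale (- k / f x1) x1)" for k
      unfolding T_def f_scale using fx1 by simp
    then show "span {x0} \<subseteq> range T"
      by (auto simp: span_singleton)
  qed
  then have "rank_one T"
    using x0 dim_eq_card[of "{x0}" "range T"] by (simp add: rank_one_def span_span dependent_single)
  with D T have daugavet_eq: "onorm (\<lambda>x. x + T x) = 1 + onorm T"
    by (simp add: daugavet_property_def)
  have pos: "0 < \<delta> * norm x0"
    using \<delta> x0 by simp
  have "(1 - \<delta>) * norm x0 \<le> norm (T x1)"
    using x1 by (simp add: norm_T mult_right_mono)
  also have "\<dots> \<le> onorm T * 1"
    using onorm[OF lin, of x1] mult_left_mono[OF x1(1) onorm_pos_le[OF lin]] by linarith
  finally have onorm_T: "norm x0 - \<delta> * norm x0 \<le> onorm T"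
    by (simp add: algebra_simps)
  define L where "L = 1 + norm x0 - 2 * (\<delta> * norm x0)"
  have \<delta>x0: "\<delta> * norm x0 \<le> 1 / 4 * norm x0"
    using \<delta> by (intro mult_right_mono) auto
  then have L: "L \<ge> 1 + norm x0 / 2"
    unfolding L_def by simp
  obtain x where x: "L * norm x < norm (x + T x)"
  proof (rule ccontr)
    assume "\<not> thesis"
    then have "norm (x + T x) \<le> L * norm x" for x
      using that by (meson not_le)
    then have "onorm (\<lambda>x. x + T x) \<le> L"
      using L norm_ge_zero[of x0] by (intro onorm_bound) linarith+
    then show False
      using daugavet_eq onorm_T pos unfolding L_def by linarith
  qed
  have x_nz: "norm x > 0"
    using x by (cases "x = 0") (auto simp: T_def f_scale[of 0 0, simplified])
  have fx_nz: "f x \<noteq> 0"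
  proof
    assume "f x = 0"
    then have "L * norm x < 1 * norm x" using x by (simp add: T_def)
    then show False using L x_nz norm_ge_zero[of x0] by (simp only: mult_less_cancel_right_pos)
  qed
  \<comment> \<open>Multiplying by \<open>c\<close> normalises \<open>x\<close> and rotates \<open>f x\<close> to the nonnegative real axis.\<close>
  define c :: 'k where "c = of_real (inverse (norm x)) * (of_real (inverse (norm (f x))) * conj_scalar (f x))"
  define s where "s = inverse (norm x) * norm (f x)"
  have norm_c: "norm c = inverse (norm x)"
    unfolding c_def norm_mult norm_of_real norm_conj_scalar using fx_nz by simp
  have "f (scale c x) = of_real (inverse (norm x)) * (of_real (inverse (norm (f x))) * (f x * conj_scalar (f x)))"
    by (simp add: f_scale c_def mult_ac)
  also have "\<dots> = of_real (inverse (norm x) * (inverse (norm (f x)) * (norm (f x))\<^sup>2))"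
    by (simp only: mult_conj_scalar_self of_real_mult)
  also have "inverse (norm x) * (inverse (norm (f x)) * (norm (f x))\<^sup>2) = s"
    using fx_nz by (simp add: s_def power2_eq_square)
  finally have fy: "f (scale c x) = of_real s" .
  have norm_y: "norm (scale c x) = 1"
    using x_nz by (simp add: norm_scale norm_c)
  have s: "0 \<le> s" "s \<le> 1"
    using f_le[of "scale c x"] unfolding fy norm_y norm_of_real by (simp_all add: s_def)
  have "scale c (x + T x) = scale c x - s *\<^sub>R x0"
    unfolding scale_right_distrib T_scale[symmetric] by (simp add: T_def fy scale_of_real)
  then have "norm (scale c x - s *\<^sub>R x0) = inverse (norm x) * norm (x + T x)"
    by (metis norm_scale norm_c)
  also have "\<dots> > L"
    using x x_nz by (simp add: field_simps)
  finally have far: "L < norm (scale c x - s *\<^sub>R x0)" .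
  also have "\<dots> \<le> 1 + s * norm x0"
    using norm_triangle_ineq4[of "scale c x" "s *\<^sub>R x0"] s by (simp add: norm_y)
  finally have "(1 - 2 * \<delta>) * norm x0 \<le> s * norm x0"
    unfolding L_def by (simp add: algebra_simps)
  then have s_ge: "1 - 2 * \<delta> \<le> s"
    using x0 by simp
  have "norm (scale c x - s *\<^sub>R x0) \<le> norm (scale c x - x0) + norm ((1 - s) *\<^sub>R x0)"
    by (rule order_trans[OF _ norm_triangle_ineq]) (simp add: algebra_simps)
  also have "norm ((1 - s) *\<^sub>R x0) \<le> 2 * \<delta> * norm x0"
    using s s_ge by (simp add: mult_right_mono)
  finally have "1 + norm x0 - 4 * \<delta> * norm x0 \<le> norm (scale c x - x0)"
    using far unfolding L_def by simp
  then show ?thesis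
    using that[of "scale c x" s] norm_y fy s_ge by simp
qed

context quotient_coordinates
begin

abbreviation coord_norm :: "'a \<Rightarrow> real" where
  "coord_norm x \<equiv> l2_norm n (\<lambda>i. q i x)"

lemma coord_norm_scaleR: "coord_norm (r *\<^sub>R x) = \<bar>r\<bar> * coord_norm x"
proof -
  have "coord_norm (r *\<^sub>R x) = L2_set (\<lambda>i. \<bar>r\<bar> * norm (q i x)) {..<n}"
    by (intro L2_set_cong) (simp_all add: q_scaleR norm_mult)
  then show ?thesis by (simp add: L2_set_right_distrib)
qed

lemma norm_q_le_coord_norm: "i < n \<Longrightarrow> norm (q i x) \<le> coord_norm x"
  by (rule member_le_L2_set) auto

text \<open>
  The number \<open>r\<close> is the supremum of \<open>coord_norm\<close> over the unit ball.
\<close>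

lemma coord_norm_sharp_bound:
  assumes n: "n \<ge> 1"
  obtains r where "r > 0" "\<And>x. coord_norm x \<le> r * norm x"
    "\<And>c. c < r \<Longrightarrow> \<exists>x. norm x \<le> 1 \<and> c < coord_norm x"
proof -
  let ?N = "coord_norm ` cball 0 1"
  have "coord_norm x \<le> real n * \<bar>C\<bar>" if "norm x \<le> 1" for x
  proof -
    have "coord_norm x \<le> (\<Sum>i<n. norm (q i x))"
      by (rule L2_set_le_sum) auto
    also have "\<dots> \<le> (\<Sum>i<n. \<bar>C\<bar>)"
    proof (rule sum_mono)
      fix i assume "i \<in> {..<n}"
      then have "norm (q i x) \<le> C * norm x" by (simp add: norm_q_le)
      also have "\<dots> \<le> \<bar>C\<bar> * 1" using that by (intro mult_mono) auto
      finally show "norm (q i x) \<le> \<bar>C\<bar>" by simp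
    qed
    finally show ?thesis by simp
  qed
  then have bdd: "bdd_above ?N"
    by (intro bdd_aboveI[of _ "real n * \<bar>C\<bar>"]) auto
  have upper: "coord_norm x \<le> Sup ?N * norm x" for x
  proof (cases "x = 0")
    case True
    then show ?thesis using coord_norm_scaleR[of 0 x] by simp
  next
    case False
    then have "coord_norm (inverse (norm x) *\<^sub>R x) \<le> Sup ?N"
      by (intro cSup_upper[OF _ bdd] imageI) simp
    then show ?thesis
      using False by (simp add: coord_norm_scaleR field_simps)
  qed
  have "1 \<le> coord_norm (e 0)"
    using norm_q_le_coord_norm[of 0 "e 0"] q_e[of 0 0] n by simp
  then have "0 < Sup ?N * norm (e 0)"
    using upper[of "e 0"] by linarith
  then have pos: "0 < Sup ?N"
    by (simp add: zero_less_mult_iff not_less[symmetric])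
  have "\<exists>x. norm x \<le> 1 \<and> c < coord_norm x" if "c < Sup ?N" for c
    using that less_cSup_iff[OF _ bdd, of c] by auto
  with pos upper show ?thesis by (rule that)
qed

text \<open>
  Put \<open>Q = Id - P\<close>, which preserves the coordinates modulo \<open>Y\<close> and depends on them only. Let \<open>x1\<close> in the
  unit ball almost maximise the Euclidean norm of the coordinates, and \<open>x0 = Q x1\<close>; it has the same
  coordinates as \<open>x1\<close>, hence norm almost at least \<open>1\<close>. Points \<open>y\<close> of the unit ball in the slice defined by
  pairing with \<open>x1\<close> have coordinates close to those of \<open>x1\<close>, because the coordinate norm is Euclidean and
  \<open>x1\<close> is almost maximal. So \<open>Q y\<close> is close to \<open>x0\<close>. The Daugavet property provides such a \<open>y\<close> with
  \<open>\<parallel>y - x0\<parallel>\<close> close to \<open>1 + \<parallel>x0\<parallel>\<close>, and \<open>P y = y - Q y\<close> then has norm almost at least \<open>2\<close>.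
\<close>

lemma norm_projection_ge:
  assumes D: "daugavet_property" and n: "n \<ge> 1" and P: "P \<in> projections_onto Y"
  shows "2 \<le> onorm P"
proof -
  have lin: "bounded_linear P" and P_Y: "\<And>x. P x \<in> Y" and P_id: "\<And>y. y \<in> Y \<Longrightarrow> P y = y"
    and P_linear: "Vector_Spaces.linear scale scale P"
    using P by (auto simp: projections_onto_def bounded_operator_def)
  interpret P: Vector_Spaces.linear scale scale P by (rule P_linear)
  define Q where "Q x = x - P x" for x
  have Q_add: "Q (x + y) = Q x + Q y" and Q_diff: "Q (x - y) = Q x - Q y" for x y
    by (simp_all add: Q_def P.add P.diff)
  have Q_scale: "Q (scale c x) = scale c (Q x)" for c x
    by (simp add: Q_def P.scale scale_right_diff_distrib)
  have Q_sum: "Q (\<Sum>i\<in>I. g i) = (\<Sum>i\<in>I. Q (g i))" for g :: "nat \<Rightarrow> 'a" and I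
    by (simp add: Q_def P.sum sum_subtractf)
  have q_Q: "q i (Q x) = q i x" if "i < n" for i x
    using that P_Y[of x] by (simp add: Q_def q_diff mem_Y_iff)
  define A where "A = (\<Sum>i<n. norm (Q (e i)))"
  have A: "A \<ge> 0" by (simp add: A_def sum_nonneg)
  have norm_Q_le: "norm (Q x) \<le> A * coord_norm x" for x
  proof -
    have "x - (\<Sum>i<n. scale (q i x) (e i)) \<in> Y"
      by (auto simp: mem_Y_iff q_diff q_sum q_scale q_e if_distrib cong: if_cong)
    then have "Q (x - (\<Sum>i<n. scale (q i x) (e i))) = 0"
      by (simp add: Q_def[of "x - _"] P_id)
    then have "Q x = (\<Sum>i<n. scale (q i x) (Q (e i)))"
      by (simp add: Q_diff Q_sum Q_scale)
    also have "norm \<dots> \<le> (\<Sum>i<n. norm (Q (e i)) * coord_norm x)"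
    proof (rule sum_norm_le)
      fix i assume "i \<in> {..<n}"
      then show "norm (scale (q i x) (Q (e i))) \<le> norm (Q (e i)) * coord_norm x"
        using norm_q_le_coord_norm[of i x] by (simp add: norm_scale mult.commute mult_left_mono)
    qed
    finally show ?thesis by (simp add: A_def sum_distrib_right)
  qed
  have P_le: "norm (P x) \<le> onorm P * norm x" for x
    by (rule onorm[OF lin])
  obtain r where r: "r > 0" and N_le: "\<And>x. coord_norm x \<le> r * norm x"
    and attained: "\<And>c. c < r \<Longrightarrow> \<exists>x. norm x \<le> 1 \<and> c < coord_norm x"
    using coord_norm_sharp_bound[OF n] by blast
  have "2 - \<delta> - 8 * \<delta> * (1 + onorm P) - A * (r * sqrt (8 * \<delta>)) \<le> onorm P"
    if \<delta>: "0 < \<delta>" "\<delta> < 1 / 8" for \<delta>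
  proof -
    have "(1 - \<delta>) * r < r" using \<delta> r by simp
    then obtain x1 where x1: "norm x1 \<le> 1" "(1 - \<delta>) * r < coord_norm x1"
      using attained by blast
    define x0 where "x0 = Q x1"
    have "coord_norm x0 = coord_norm x1"
      unfolding x0_def by (intro L2_set_cong) (simp_all add: q_Q)
    then have "(1 - \<delta>) * r < norm x0 * r"
      using x1(2) N_le[of x0] by (simp add: mult.commute)
    then have norm_x0: "1 - \<delta> < norm x0"
      using r by simp
    then have x0_nz: "x0 \<noteq> 0" using \<delta> by auto
    \<comment> \<open>The factor makes \<open>f\<close> a contraction that almost attains its norm bound \<open>1\<close> at \<open>x1\<close>.\<close>
    define f where "f x = of_real (inverse (r\<^sup>2)) * pairing n (\<lambda>i. q i x) (\<lambda>i. q i x1)" for x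
    have f_add: "f (x + y) = f x + f y" for x y
      by (simp add: f_def pairing_def q_add distrib_right sum.distrib distrib_left)
    have f_scale: "f (scale c x) = c * f x" for c x
      by (simp add: f_def pairing_def q_scale sum_distrib_left mult_ac)
    have N_le_r: "coord_norm y \<le> r" if "norm y \<le> 1" for y
      using N_le[of y] mult_left_mono[OF that, of r] r by linarith
    have f_le: "norm (f x) \<le> norm x" for x
    proof -
      have "norm (pairing n (\<lambda>i. q i x) (\<lambda>i. q i x1)) \<le> coord_norm x * coord_norm x1"
        by (rule norm_pairing_le)
      also have "\<dots> \<le> (r * norm x) * r"
        using N_le N_le_r[OF x1(1)] r by (intro mult_mono) auto
      finally have "norm (pairing n (\<lambda>i. q i x) (\<lambda>i. q i x1)) \<le> r\<^sup>2 * norm x"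
        by (simp add: power2_eq_square mult_ac)
      moreover have "norm (f x) = inverse (r\<^sup>2) * norm (pairing n (\<lambda>i. q i x) (\<lambda>i. q i x1))"
        unfolding f_def norm_mult norm_of_real by simp
      moreover have "inverse (r\<^sup>2) * (r\<^sup>2 * norm x) = norm x"
        using r by simp
      ultimately show ?thesis
        using mult_left_mono[of _ _ "inverse (r\<^sup>2)"] r by (metis inverse_nonnegative_iff_nonnegative zero_le_power2)
    qed
    have "(1 - 2 * \<delta>) * r\<^sup>2 \<le> ((1 - \<delta>) * r)\<^sup>2"
      using \<delta> by (simp add: power_mult_distrib power2_diff mult_right_mono)
    also have "\<dots> \<le> (coord_norm x1)\<^sup>2"
      using x1(2) \<delta> r by (intro power_mono) auto
    also have "\<dots> = norm (f x1) * r\<^sup>2"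
      using r unfolding f_def pairing_self norm_mult norm_of_real by simp
    finally have "1 - 2 * \<delta> \<le> norm (f x1)"
      using r by simp
    then obtain y s where y: "norm y \<le> 1" "f y = of_real s" "1 - 2 * (2 * \<delta>) \<le> s"
      and far: "1 + norm x0 - 4 * (2 * \<delta>) * norm x0 \<le> norm (y - x0)"
      using daugavet_slice[OF D f_add f_scale f_le, of "2 * \<delta>" x1 x0] \<delta> x1 x0_nz by auto
    have "pairing n (\<lambda>i. q i y) (\<lambda>i. q i x1) = of_real (r\<^sup>2) * f y"
      using r by (simp add: f_def)
    then have "pairing n (\<lambda>i. q i y) (\<lambda>i. q i x1) = of_real (r\<^sup>2 * s)"
      by (simp only: y(2) of_real_mult)
    then have re: "Re (to_complex (pairing n (\<lambda>i. q i y) (\<lambda>i. q i x1))) = r\<^sup>2 * s"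
      by (simp only: to_complex_of_real Re_complex_of_real)
    have "coord_norm (y - x1) = l2_norm n (\<lambda>i. q i y - q i x1)"
      by (intro L2_set_cong) (simp_all add: q_diff)
    then have "(coord_norm (y - x1))\<^sup>2 = (coord_norm y)\<^sup>2 + (coord_norm x1)\<^sup>2 - 2 * (r\<^sup>2 * s)"
      by (simp only: l2_norm_diff_squared re)
    also have "\<dots> \<le> r\<^sup>2 + r\<^sup>2 - 2 * (r\<^sup>2 * (1 - 4 * \<delta>))"
      using N_le_r[OF y(1)] N_le_r[OF x1(1)] y(3) r
      by (intro diff_mono add_mono power_mono mult_left_mono) auto
    also have "\<dots> = (r * sqrt (8 * \<delta>))\<^sup>2"
      using \<delta> by (simp add: power_mult_distrib algebra_simps)
    finally have near: "coord_norm (y - x1) \<le> r * sqrt (8 * \<delta>)"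
      using r \<delta> by (simp add: power2_le_iff_abs_le)
    have "P y = (y - x0) - Q (y - x1)"
      by (simp add: x0_def Q_def P.diff)
    then have "norm (y - x0) - norm (Q (y - x1)) \<le> norm (P y)"
      by (metis norm_triangle_ineq2)
    moreover have "norm (P y) \<le> onorm P"
      using P_le[of y] mult_left_mono[OF y(1) onorm_pos_le[OF lin]] by linarith
    moreover have "norm (Q (y - x1)) \<le> A * (r * sqrt (8 * \<delta>))"
      using norm_Q_le[of "y - x1"] mult_left_mono[OF near A] by linarith
    moreover have "norm x0 \<le> 1 + onorm P"
    proof -
      have "norm x0 \<le> norm x1 + norm (P x1)"
        unfolding x0_def Q_def by (rule norm_triangle_ineq4)
      also have "norm (P x1) \<le> onorm P"
        using P_le[of x1] mult_left_mono[OF x1(1) onorm_pos_le[OF lin]] by linarith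
      finally show ?thesis using x1(1) by simp
    qed
    then have "8 * \<delta> * norm x0 \<le> 8 * \<delta> * (1 + onorm P)"
      using \<delta> by (intro mult_left_mono) auto
    ultimately show ?thesis
      using far norm_x0 by simp
  qed
  then have ev: "\<forall>\<^sub>F \<delta> in at_right 0. 2 - \<delta> - 8 * \<delta> * (1 + onorm P) - A * (r * sqrt (8 * \<delta>)) \<le> onorm P"
    by (intro eventually_at_rightI[of 0 "1 / 8"]) auto
  have "((\<lambda>\<delta>. 2 - \<delta> - 8 * \<delta> * (1 + onorm P) - A * (r * sqrt (8 * \<delta>))) \<longlongrightarrow>
      2 - 0 - 8 * 0 * (1 + onorm P) - A * (r * sqrt (8 * 0))) (at_right 0)"
    by (intro tendsto_intros)
  then have "2 - 0 - 8 * 0 * (1 + onorm P) - A * (r * sqrt (8 * 0)) \<le> onorm P"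
    using ev by (rule tendsto_upperbound) simp
  then show ?thesis by simp
qed

lemma projection_constant_ge:
  assumes "daugavet_property" "n \<ge> 1"
  shows "2 \<le> projection_constant Y"
  unfolding projection_constant_def
  using norm_projection_ge[OF assms] by (intro INF_greatest) simp

end

lemma (in banach_over) has_codim_ge_1:
  assumes "has_codim Y n" "Y \<noteq> UNIV"
  shows "n \<ge> 1"
proof (rule ccontr)
  assume "\<not> n \<ge> 1"
  obtain B where "finite B" "card B = n" and spans: "\<And>x. \<exists>c. x - (\<Sum>b\<in>B. scale (c b) b) \<in> Y"
    using assms(1) unfolding has_codim_def by blast
  moreover from this \<open>\<not> n \<ge> 1\<close> have "card B = 0" by simp
  ultimately have "B = {}" by simp
  then have "x \<in> Y" for x
    using spans[of x] by simp
  with assms(2) show False by auto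
qed

lemma (in banach_over) closed_hyperplane_ne_UNIV:
  assumes "closed_hyperplane H"
  shows "H \<noteq> UNIV"
proof
  assume "H = UNIV"
  moreover obtain B where "card B = 1" "\<And>c. (\<Sum>b\<in>B. scale (c b) b) \<in> H \<longrightarrow> (\<forall>b\<in>B. c b = 0)"
    using assms unfolding closed_hyperplane_def has_codim_def by blast
  from this(2)[of "\<lambda>_. 1"] this(1) \<open>H = UNIV\<close> show False
    by (auto simp: card_1_singleton_iff)
qed

lemma (in banach_over) projection_constant_bounds:
  assumes D: daugavet_property and Y: "closed_subspace Y" "Y \<noteq> UNIV" "has_codim Y n"
  shows "2 \<le> projection_constant Y \<and> projection_constant Y \<le> ereal (1 + sqrt (real n))"
proof -
  obtain q e C where "quotient_coordinates scale Y n q e C"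
    using quotient_coordinates_exist[OF Y(1,3)] by blast
  then interpret quotient_coordinates scale Y n q e C .
  show ?thesis
    using projection_constant_ge[OF D] projection_constant_le has_codim_ge_1[OF Y(3,2)] by simp
qed

theorem corollary3p2:
  fixes scale :: "'k::real_or_complex \<Rightarrow> 'a::banach \<Rightarrow> 'a"
  assumes "banach_over scale"
    and "banach_over.daugavet_property scale"
  shows "(\<forall>Y n. banach_over.closed_subspace scale Y \<and> Y \<noteq> UNIV \<and> banach_over.has_codim scale Y n \<longrightarrow>
            2 \<le> banach_over.projection_constant scale Y \<and>
            banach_over.projection_constant scale Y \<le> ereal (1 + sqrt (real n))) \<and>
         (\<forall>H. banach_over.closed_hyperplane scale H \<longrightarrow>
            banach_over.projection_constant scale H = 2)"
proof -
  interpret banach_over scale by (rule assms(1))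
  have "projection_constant H = 2" if H: "closed_hyperplane H" for H
  proof -
    have "2 \<le> projection_constant H \<and> projection_constant H \<le> ereal (1 + sqrt (real 1))"
      using H closed_hyperplane_ne_UNIV[OF H] unfolding closed_hyperplane_def
      by (intro projection_constant_bounds[OF assms(2)]) auto
    then show ?thesis by (simp add: antisym)
  qed
  then show ?thesis
    using projection_constant_bounds[OF assms(2)] by blast
qed

end
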